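(* Let $t\mapsto q^\flat(t)$, $t\in[t_0,t_f^\flat]$, be a hidden algorithm primitive for Problem $(N)$ generated by the action of a control function $t\mapsto u^\flat(t)$ from the point $q(t_0)=q^{00}$. Suppose there exists a continuously differentiable function $\varphi:(q,t)\mapsto\mathbb R$ that satisfies $$\begin{aligned} \mathcal H\big(q,\partial_q\varphi(q,t),t\big)+\partial_t\varphi(q,t)&\ge0 &&\forall\,q,\ \forall\,t\in[t_0,t_f],\\ \varphi(q(t_f),t_f)&=\ell(q(t_f),t_f)&&\forall\,q(t_f)\in T,\\ \varphi(q(t_0),t_0)&=J[q^\flat(\cdot),u^\flat(\cdot),t_f^\flat]. \end{aligned}$$ Then $q^\flat(\cdot)$ is an optimal hidden algorithm primitive (i.e. $(q^\flat(\cdot),u^\flat(\cdot),t^\flat_f)$ solves Problem $(M)$), with optimal value given by $\varphi(q^{00},t_0)$.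
   Context: Problem $(N)$: minimize $g_0(q_1)$ over $q_1\in\mathbb R^n$ subject to $g^L\le g(q_1)\le g^U$, with $g_0:\mathbb R^n\to\mathbb R$, $g:\mathbb R^n\to\mathbb R^m$ twice continuously differentiable and $g^L,g^U\in\mathbb R^m$. Generalized Lagrangian: $L(q_0,q_1,q_2):=q_0g_0(q_1)+\langle q_2,g(q_1)\rangle$. State $q=(q_0,q_1,q_2,q_3,q_4,q_5)\in\mathbb R\times\mathbb R^n\times\mathbb R^m\times\mathbb R^n\times\mathbb R^m\times\mathbb R=\mathbb R^{2(1+n+m)}$, control $u=(u_0,u_1,u_2)\in\mathbb R\times\mathbb R^n\times\mathbb R^m$. The vector field is $$F(q,u):=\Big(u_0,\ u_1,\ u_2,\ -[\partial^2_{q_1}L(q_0,q_1,q_2)]u_1-\partial_{q_1}L(u_0,q_1,u_2),\ [\partial_{q_1}g(q_1)]u_1,\ \langle\partial_{q_1}g_0(q_1),u_1\rangle\Big),$$ where $\partial_{q_1}$, $\partial^2_{q_1}$ denote gradient (Jacobian for $g$) and Hessian in $q_1$. Target set: $T:=\{q:\ q_0\ge0,\ (q_0,q_2)\neq(0,0),\ q_3=0,\ g^L\le q_4\le g^U,\ q_2\,\dag\,q_4\}$, where $q_2\,\dag\,q_4$ means, for each $i$: $q_2^i$ is unrestricted if $g^L_i=g^U_i$; otherwise $q_2^i\le0$ if $q_4^i=g^L_i$, $q_2^i=0$ if $g^L_i<q_4^i<g^U_i$, $q_2^i\ge0$ if $q_4^i=g^U_i$. Hidden algorithm primitive for $(N)$: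 a Carathéodory solution $[t_0,t_f]\ni t\mapsto q(t)$ of $\dot q=F(q,u(t))$, $q(t_0)=q^{00}$, for a measurable control function $u(\cdot)$ that drives $q^{00}$ to $q(t_f)\in T$. Here $\mathbb U(q,t)\subset\mathbb R^{1+n+m}$ is a given compact set of allowable control values for each $(q,t)$, and controls satisfy $u(t)\in\mathbb U(q(t),t)$. Cost functional: $J[q(\cdot),u(\cdot),t_f]:=\ell(q(t_f),t_f)+\int_{t_0}^{t_f}\mathcal L(q(t),u(t),t)\,dt$, with given differentiable endpoint cost $\ell:(q,t)\mapsto\mathbb R$ and differentiable running cost $\mathcal L:(q,u,t)\mapsto\mathbb R$. Problem $(M)$: minimize $J[q(\cdot),u(\cdot),t_f]$ over $[q(\cdot),u(\cdot),t_f]$ subject to $\dot q(t)=F(q(t),u(t))$, $u(t)\in\mathbb U(q(t),t)$, $q(t_0)=q^{00}$, $q(t_f)\in T$. An optimal hidden algorithm primitive is the state trajectory of a solution of $(M)$. Pontryagin Hamiltonian: $H(q,\lambda,u,t):=\mathcal L(q,u,t)+\langle\lambda,F(q,u)\rangle$ for $\lambda\in\mathbb R^{2(1+n+m)}$. Lower Hamiltonian: $\mathcal H(q,\lambda,t):=\min_{u\in\mathbb U(q,t)}H(q,\lambda,u,t)$. *)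

theory Defs
  imports "HOL-Analysis.Analysis"
begin

section \<open>Differential calculus\<close>

definition C1 :: "('a::real_normed_vector \<Rightarrow> 'b::real_normed_vector) \<Rightarrow> bool" where
  "C1 f \<longleftrightarrow> (\<exists>f' :: 'a \<Rightarrow> 'a \<Rightarrow>\<^sub>L 'b.
      (\<forall>x. (f has_derivative blinfun_apply (f' x)) (at x)) \<and> continuous_on UNIV f')"

definition C2 :: "('a::real_normed_vector \<Rightarrow> 'b::real_normed_vector) \<Rightarrow> bool" where
  "C2 f \<longleftrightarrow> (\<exists>f' :: 'a \<Rightarrow> 'a \<Rightarrow>\<^sub>L 'b.
      (\<forall>x. (f has_derivative blinfun_apply (f' x)) (at x)) \<and> C1 f')"

definition grad :: "('a::real_inner \<Rightarrow> real) \<Rightarrow> 'a \<Rightarrow> 'a" where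
  "grad f x = (THE D. GDERIV f x :> D)"

lemma grad_eqI:
  assumes "GDERIV f x :> D"
  shows "grad f x = D"
  unfolding grad_def
proof (rule the_equality)
  show "GDERIV f x :> D" by (rule assms)
next
  fix E assume "GDERIV f x :> E"
  with assms have "(\<lambda>h. inner h E) = (\<lambda>h. inner h D)"
    unfolding gderiv_def by (rule has_derivative_unique[rotated])
  from fun_cong[OF this, of "E - D"] have "inner (E - D) (E - D) = 0"
    by (simp add: inner_diff_right)
  then show "E = D"
    by simp
qed

definition hessian :: "(real^'n \<Rightarrow> real) \<Rightarrow> real^'n \<Rightarrow> real^'n^'n" where
  "hessian f x = jacobian (grad f) (at x)"

section \<open>Caratheodory solutions\<close>

definition abs_cont_on :: "real \<Rightarrow> real \<Rightarrow> (real \<Rightarrow> 'a::real_normed_vector) \<Rightarrow> bool" where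
  "abs_cont_on a b f \<longleftrightarrow>
     (\<forall>\<epsilon>>0. \<exists>\<delta>>0. \<forall>(n::nat) x y.
        (\<forall>i<n. a \<le> x i \<and> x i \<le> y i \<and> y i \<le> b) \<and>
        disjoint_family_on (\<lambda>i. {x i<..<y i}) {..<n} \<and>
        (\<Sum>i<n. y i - x i) < \<delta>
        \<longrightarrow> (\<Sum>i<n. norm (f (y i) - f (x i))) < \<epsilon>)"

definition caratheodory_solution ::
  "(real \<Rightarrow> 'a::real_normed_vector \<Rightarrow> 'a) \<Rightarrow> real \<Rightarrow> real \<Rightarrow> (real \<Rightarrow> 'a) \<Rightarrow> bool" where
  "caratheodory_solution f a b q \<longleftrightarrow>
     abs_cont_on a b q \<and>
     (AE t in lebesgue_on {a..b}. (q has_vector_derivative f t (q t)) (at t within {a..b}))"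

section \<open>Hidden algorithm primitives\<close>

type_synonym ('n, 'm) state =
  "real \<times> (real^'n) \<times> (real^'m) \<times> (real^'n) \<times> (real^'m) \<times> real"

type_synonym ('n, 'm) control = "real \<times> (real^'n) \<times> (real^'m)"

definition gen_lagrangian ::
  "(real^'n \<Rightarrow> real) \<Rightarrow> (real^'n \<Rightarrow> real^'m) \<Rightarrow> real \<Rightarrow> real^'n \<Rightarrow> real^'m \<Rightarrow> real" where
  "gen_lagrangian g0 g q0 q1 q2 = q0 * g0 q1 + q2 \<bullet> g q1"

fun vfield ::
  "(real^'n \<Rightarrow> real) \<Rightarrow> (real^'n \<Rightarrow> real^'m) \<Rightarrow>
   ('n::finite, 'm::finite) state \<Rightarrow> ('n, 'm) control \<Rightarrow> ('n, 'm) state" where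
  "vfield g0 g (q0, q1, q2, q3, q4, q5) (u0, u1, u2) =
     (u0, u1, u2,
      - (hessian (\<lambda>x. gen_lagrangian g0 g q0 x q2) q1 *v u1)
        - grad (\<lambda>x. gen_lagrangian g0 g u0 x u2) q1,
      jacobian g (at q1) *v u1,
      grad g0 q1 \<bullet> u1)"

definition compl_cond ::
  "real^'m \<Rightarrow> real^'m \<Rightarrow> real^'m \<Rightarrow> real^'m \<Rightarrow> bool" where
  "compl_cond gL gU q2 q4 \<longleftrightarrow>
     (\<forall>i. gL $ i \<noteq> gU $ i \<longrightarrow>
        (q4 $ i = gL $ i \<longrightarrow> q2 $ i \<le> 0) \<and>
        (gL $ i < q4 $ i \<and> q4 $ i < gU $ i \<longrightarrow> q2 $ i = 0) \<and>
        (q4 $ i = gU $ i \<longrightarrow> q2 $ i \<ge> 0))"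

definition target :: "real^'m \<Rightarrow> real^'m \<Rightarrow> ('n::finite, 'm::finite) state set" where
  "target gL gU = {(q0, q1, q2, q3, q4, q5).
     q0 \<ge> 0 \<and> (q0, q2) \<noteq> (0, 0) \<and> q3 = 0 \<and> gL \<le> q4 \<and> q4 \<le> gU \<and>
     compl_cond gL gU q2 q4}"

text \<open>The trajectory \<open>q\<close> on \<open>[t0, tf]\<close> is a hidden algorithm primitive generated by the control
  \<open>u\<close> from \<open>q00\<close>.  These conditions are also exactly the constraints of Problem (M).
  Values of \<open>q\<close> and \<open>u\<close> outside \<open>[t0, tf]\<close> are irrelevant.\<close>

definition hidden_primitive ::
  "(real^'n \<Rightarrow> real) \<Rightarrow> (real^'n \<Rightarrow> real^'m) \<Rightarrow> real^'m \<Rightarrow> real^'m \<Rightarrow>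
   (('n::finite, 'm::finite) state \<Rightarrow> real \<Rightarrow> ('n, 'm) control set) \<Rightarrow>
   real \<Rightarrow> ('n, 'm) state \<Rightarrow>
   (real \<Rightarrow> ('n, 'm) state) \<Rightarrow> (real \<Rightarrow> ('n, 'm) control) \<Rightarrow> real \<Rightarrow> bool" where
  "hidden_primitive g0 g gL gU U t0 q00 q u tf \<longleftrightarrow>
     t0 \<le> tf \<and>
     u \<in> borel_measurable (lebesgue_on {t0..tf}) \<and>
     caratheodory_solution (\<lambda>t x. vfield g0 g x (u t)) t0 tf q \<and>
     (\<forall>t\<in>{t0..tf}. u t \<in> U (q t) t) \<and>
     q t0 = q00 \<and>
     q tf \<in> target gL gU"

section \<open>The optimal control problem (M)\<close>

text \<open>The running cost need not be integrable along a primitive, so its integral is taken in the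
  extended reals as the integral of the positive part minus that of the negative part.  If both
  are infinite the value is \<open>\<infinity>\<close>, as \<open>\<infinity> - \<infinity> = \<infinity>\<close> in type \<^typ>\<open>ereal\<close>.\<close>

definition cost ::
  "('s \<Rightarrow> real \<Rightarrow> real) \<Rightarrow> ('s \<Rightarrow> 'c \<Rightarrow> real \<Rightarrow> real) \<Rightarrow> real \<Rightarrow>
   (real \<Rightarrow> 's) \<Rightarrow> (real \<Rightarrow> 'c) \<Rightarrow> real \<Rightarrow> ereal" where
  "cost ell Lrun t0 q u tf =
     ereal (ell (q tf) tf) +
     (enn2ereal (\<integral>\<^sup>+t. ennreal (Lrun (q t) (u t) t) \<partial>lebesgue_on {t0..tf})
      - enn2ereal (\<integral>\<^sup>+t. ennreal (- Lrun (q t) (u t) t) \<partial>lebesgue_on {t0..tf}))"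

lemma cost_integrable:
  assumes "integrable (lebesgue_on {t0..tf}) (\<lambda>t. Lrun (q t) (u t) t)"
  shows "cost ell Lrun t0 q u tf =
    ereal (ell (q tf) tf + (\<integral>t. Lrun (q t) (u t) t \<partial>lebesgue_on {t0..tf}))"
proof -
  obtain r s where rs: "0 \<le> r" "0 \<le> s"
    "(\<integral>\<^sup>+t. ennreal (Lrun (q t) (u t) t) \<partial>lebesgue_on {t0..tf}) = ennreal r"
    "(\<integral>\<^sup>+t. ennreal (- Lrun (q t) (u t) t) \<partial>lebesgue_on {t0..tf}) = ennreal s"
    "(\<integral>t. Lrun (q t) (u t) t \<partial>lebesgue_on {t0..tf}) = r - s"
    by (rule integrableE[OF assms])
  show ?thesis
    unfolding cost_def rs(3,4,5) using rs(1,2) by (simp add: enn2ereal_ennreal)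
qed

definition solves_M ::
  "(real^'n \<Rightarrow> real) \<Rightarrow> (real^'n \<Rightarrow> real^'m) \<Rightarrow> real^'m \<Rightarrow> real^'m \<Rightarrow>
   (('n::finite, 'm::finite) state \<Rightarrow> real \<Rightarrow> ('n, 'm) control set) \<Rightarrow>
   (('n, 'm) state \<Rightarrow> real \<Rightarrow> real) \<Rightarrow>
   (('n, 'm) state \<Rightarrow> ('n, 'm) control \<Rightarrow> real \<Rightarrow> real) \<Rightarrow>
   real \<Rightarrow> ('n, 'm) state \<Rightarrow>
   (real \<Rightarrow> ('n, 'm) state) \<Rightarrow> (real \<Rightarrow> ('n, 'm) control) \<Rightarrow> real \<Rightarrow> bool" where
  "solves_M g0 g gL gU U ell Lrun t0 q00 q u tf \<longleftrightarrow>
     hidden_primitive g0 g gL gU U t0 q00 q u tf \<and>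
     (\<forall>q' u' tf'. hidden_primitive g0 g gL gU U t0 q00 q' u' tf' \<longrightarrow>
        cost ell Lrun t0 q u tf \<le> cost ell Lrun t0 q' u' tf')"

definition optimal_primitive ::
  "(real^'n \<Rightarrow> real) \<Rightarrow> (real^'n \<Rightarrow> real^'m) \<Rightarrow> real^'m \<Rightarrow> real^'m \<Rightarrow>
   (('n::finite, 'm::finite) state \<Rightarrow> real \<Rightarrow> ('n, 'm) control set) \<Rightarrow>
   (('n, 'm) state \<Rightarrow> real \<Rightarrow> real) \<Rightarrow>
   (('n, 'm) state \<Rightarrow> ('n, 'm) control \<Rightarrow> real \<Rightarrow> real) \<Rightarrow>
   real \<Rightarrow> ('n, 'm) state \<Rightarrow> (real \<Rightarrow> ('n, 'm) state) \<Rightarrow> real \<Rightarrow> bool" where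
  "optimal_primitive g0 g gL gU U ell Lrun t0 q00 q tf \<longleftrightarrow>
     (\<exists>u. solves_M g0 g gL gU U ell Lrun t0 q00 q u tf)"

definition optimal_value ::
  "(real^'n \<Rightarrow> real) \<Rightarrow> (real^'n \<Rightarrow> real^'m) \<Rightarrow> real^'m \<Rightarrow> real^'m \<Rightarrow>
   (('n::finite, 'm::finite) state \<Rightarrow> real \<Rightarrow> ('n, 'm) control set) \<Rightarrow>
   (('n, 'm) state \<Rightarrow> real \<Rightarrow> real) \<Rightarrow>
   (('n, 'm) state \<Rightarrow> ('n, 'm) control \<Rightarrow> real \<Rightarrow> real) \<Rightarrow>
   real \<Rightarrow> ('n, 'm) state \<Rightarrow> ereal" where
  "optimal_value g0 g gL gU U ell Lrun t0 q00 =
     Inf {cost ell Lrun t0 q u tf | q u tf. hidden_primitive g0 g gL gU U t0 q00 q u tf}"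

text \<open>Problem (M) has free final time; these are the final times that occur in it.\<close>

definition final_times ::
  "(real^'n \<Rightarrow> real) \<Rightarrow> (real^'n \<Rightarrow> real^'m) \<Rightarrow> real^'m \<Rightarrow> real^'m \<Rightarrow>
   (('n::finite, 'm::finite) state \<Rightarrow> real \<Rightarrow> ('n, 'm) control set) \<Rightarrow>
   real \<Rightarrow> ('n, 'm) state \<Rightarrow> real set" where
  "final_times g0 g gL gU U t0 q00 =
     {tf. \<exists>q u. hidden_primitive g0 g gL gU U t0 q00 q u tf}"

definition hamiltonian ::
  "(real^'n \<Rightarrow> real) \<Rightarrow> (real^'n \<Rightarrow> real^'m) \<Rightarrow>
   (('n::finite, 'm::finite) state \<Rightarrow> ('n, 'm) control \<Rightarrow> real \<Rightarrow> real) \<Rightarrow>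
   ('n, 'm) state \<Rightarrow> ('n, 'm) state \<Rightarrow> ('n, 'm) control \<Rightarrow> real \<Rightarrow> real" where
  "hamiltonian g0 g Lrun q lam u t = Lrun q u t + lam \<bullet> vfield g0 g q u"

text \<open>The minimum over the compact set \<open>U q t\<close> is written as an infimum; it is attained whenever
  \<open>U q t\<close> is nonempty, see \<open>lower_hamiltonian_min\<close>.\<close>

definition lower_hamiltonian ::
  "(real^'n \<Rightarrow> real) \<Rightarrow> (real^'n \<Rightarrow> real^'m) \<Rightarrow>
   (('n::finite, 'm::finite) state \<Rightarrow> real \<Rightarrow> ('n, 'm) control set) \<Rightarrow>
   (('n, 'm) state \<Rightarrow> ('n, 'm) control \<Rightarrow> real \<Rightarrow> real) \<Rightarrow>
   ('n, 'm) state \<Rightarrow> ('n, 'm) state \<Rightarrow> real \<Rightarrow> real" where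
  "lower_hamiltonian g0 g U Lrun q lam t = (INF u\<in>U q t. hamiltonian g0 g Lrun q lam u t)"

lemma lower_hamiltonian_min:
  assumes "compact (U q t)" "U q t \<noteq> {}"
    and "continuous_on (U q t) (\<lambda>u. hamiltonian g0 g Lrun q lam u t)"
  obtains u where "u \<in> U q t"
    and "lower_hamiltonian g0 g U Lrun q lam t = hamiltonian g0 g Lrun q lam u t"
    and "\<And>v. v \<in> U q t \<Longrightarrow>
      hamiltonian g0 g Lrun q lam u t \<le> hamiltonian g0 g Lrun q lam v t"
proof -
  obtain u where u: "u \<in> U q t" and
    le: "\<And>v. v \<in> U q t \<Longrightarrow>
      hamiltonian g0 g Lrun q lam u t \<le> hamiltonian g0 g Lrun q lam v t"
    using continuous_attains_inf[OF assms] by blast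
  have "lower_hamiltonian g0 g U Lrun q lam t = hamiltonian g0 g Lrun q lam u t"
    unfolding lower_hamiltonian_def by (rule cInf_eq_minimum) (use u le in auto)
  with u le show thesis
    using that by blast
qed

end

theory Submission
  imports Defs
begin

text \<open>Along any primitive, \<open>t \<mapsto> \<phi> (q t) t\<close> is absolutely continuous, and the Hamilton--Jacobi
  inequality says that its derivative is almost everywhere at least minus the running cost.
  Integrating and using the terminal condition gives \<open>\<phi> q00 t0\<close> as a lower bound for the cost of
  every primitive, which the given one attains.\<close>

section \<open>Absolute continuity and the fundamental theorem of calculus\<close>

text \<open>\<open>abs_cont_on\<close> indexes its intervals by an initial segment of the naturals;
  a bijection with \<open>{..<card I}\<close> carries it to any finite index set, in particular to
  the tagged intervals of a division.\<close>

lemma abs_cont_on_finite: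
  fixes f :: "real \<Rightarrow> 'a::real_normed_vector"
  assumes "abs_cont_on a b f" "\<epsilon> > 0"
  shows "\<exists>\<delta>>0. \<forall>(I :: 'i set) x y. finite I \<and> (\<forall>i\<in>I. a \<le> x i \<and> x i \<le> y i \<and> y i \<le> b) \<and>
      disjoint_family_on (\<lambda>i. {x i<..<y i}) I \<and> (\<Sum>i\<in>I. y i - x i) < \<delta>
      \<longrightarrow> (\<Sum>i\<in>I. norm (f (y i) - f (x i))) < \<epsilon>"
proof -
  from assms obtain \<delta> where "\<delta> > 0" and \<delta>: "\<And>(n::nat) x y.
        (\<forall>i<n. a \<le> x i \<and> x i \<le> y i \<and> y i \<le> b) \<and>
        disjoint_family_on (\<lambda>i. {x i<..<y i}) {..<n} \<and>
        (\<Sum>i<n. y i - x i) < \<delta>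
        \<Longrightarrow> (\<Sum>i<n. norm (f (y i) - f (x i))) < \<epsilon>"
    unfolding abs_cont_on_def by meson
  have *: "(\<Sum>i\<in>I. norm (f (y i) - f (x i))) < \<epsilon>"
    if fin: "finite I" and le: "\<And>i. i \<in> I \<Longrightarrow> a \<le> x i \<and> x i \<le> y i \<and> y i \<le> b"
      and disj: "disjoint_family_on (\<lambda>i. {x i<..<y i}) I" and less: "(\<Sum>i\<in>I. y i - x i) < \<delta>"
    for I :: "'i set" and x y
  proof -
    obtain h where h: "bij_betw h {..<card I} I"
      using ex_bij_betw_nat_finite[OF fin] by (auto simp: atLeast0LessThan)
    have "(\<Sum>i<card I. norm (f (y (h i)) - f (x (h i)))) < \<epsilon>"
    proof (rule \<delta>[of "card I" "x \<circ> h" "y \<circ> h", unfolded o_def], intro conjI allI impI)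
      show "disjoint_family_on (\<lambda>i. {x (h i)<..<y (h i)}) {..<card I}"
        unfolding disjoint_family_on_def
      proof (intro ballI impI)
        fix i j assume "i \<in> {..<card I}" "j \<in> {..<card I}" "i \<noteq> j"
        then have "h i \<in> I" "h j \<in> I" "h i \<noteq> h j"
          using h by (auto simp: bij_betw_def inj_on_def)
        then show "{x (h i)<..<y (h i)} \<inter> {x (h j)<..<y (h j)} = {}"
          using disj unfolding disjoint_family_on_def by blast
      qed
      show "(\<Sum>i<card I. y (h i) - x (h i)) < \<delta>"
        using less sum.reindex_bij_betw[OF h, of "\<lambda>i. y i - x i"] by simp
    qed (use le bij_betwE[OF h] in auto)
    then show ?thesis
      using sum.reindex_bij_betw[OF h, of "\<lambda>i. norm (f (y i) - f (x i))"] by simp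
  qed
  show ?thesis
    using \<open>\<delta> > 0\<close> by (intro exI[of _ \<delta>] conjI allI impI) (assumption, elim conjE, rule *, auto)
qed

lemma abs_cont_on_imp_continuous_on:
  assumes "abs_cont_on a b f"
  shows "continuous_on {a..b} f"
  unfolding continuous_on_iff
proof (intro ballI allI impI)
  fix s \<epsilon> :: real assume s: "s \<in> {a..b}" and "\<epsilon> > 0"
  obtain \<delta> where "\<delta> > 0" and \<delta>: "\<forall>(I :: unit set) x y. finite I \<and>
      (\<forall>i\<in>I. a \<le> x i \<and> x i \<le> y i \<and> y i \<le> b) \<and>
      disjoint_family_on (\<lambda>i. {x i<..<y i}) I \<and> (\<Sum>i\<in>I. y i - x i) < \<delta>
      \<longrightarrow> (\<Sum>i\<in>I. norm (f (y i) - f (x i))) < \<epsilon>"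
    using abs_cont_on_finite[OF assms \<open>\<epsilon> > 0\<close>] by blast
  have "dist (f t) (f s) < \<epsilon>" if t: "t \<in> {a..b}" "dist t s < \<delta>" for t
    \<comment> \<open>A single interval, indexed by the one-element type \<open>unit\<close>;
      \<open>min\<close> and \<open>max\<close> cover both orders of \<open>s\<close> and
      \<open>t\<close>.\<close>
    using \<delta>[rule_format, of UNIV "\<lambda>_. min s t" "\<lambda>_. max s t"] s t
    by (cases "s \<le> t")
      (auto simp: dist_norm min_def max_def norm_minus_commute disjoint_family_on_def)
  then show "\<exists>\<delta>>0. \<forall>t\<in>{a..b}. dist t s < \<delta> \<longrightarrow> dist (f t) (f s) < \<epsilon>"
    using \<open>\<delta> > 0\<close> by blast
qed

text \<open>Off a null set the gauge comes from differentiability; the tags in the null set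
  are confined to an open set of small measure, where absolute continuity bounds the
  increments.\<close>

theorem abs_cont_on_has_integral:
  fixes f :: "real \<Rightarrow> 'a::banach"
  assumes "a \<le> b" and ac: "abs_cont_on a b f"
    and deriv: "AE t in lebesgue_on {a..b}. (f has_vector_derivative f' t) (at t within {a..b})"
  shows "(f' has_integral f b - f a) {a..b}"
proof -
  have "AE t in lebesgue. t \<in> {a..b} \<longrightarrow> (f has_vector_derivative f' t) (at t within {a..b})"
    using deriv by (simp add: AE_restrict_space_iff)
  then obtain N where N: "N \<in> null_sets lebesgue"
    and der: "\<And>t. t \<in> {a..b} - N \<Longrightarrow> (f has_vector_derivative f' t) (at t within {a..b})"
    by (auto simp: eventually_ae_filter)
  \<comment> \<open>Resetting the derivative to \<open>0\<close> on \<open>N\<close> removes the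
    Riemann terms tagged there. Since \<open>N\<close> is negligible, the integral of
    \<open>f'\<close> is recovered at the end by a spike argument.\<close>
  define h where "h t = (if t \<in> N then 0 else f' t)" for t
  have "(h has_integral f b - f a) {a..b}"
    unfolding has_integral_real
  proof (intro allI impI)
    fix e :: real assume "e > 0"
    \<comment> \<open>The \<open>+ 1\<close> keeps the denominator positive when
      \<open>a = b\<close> and makes the accumulated error strictly less than
      \<open>e / 2\<close>.\<close>
    define \<eta> where "\<eta> = e / (2 * (b - a + 1))"
    have "\<eta> > 0" and \<eta>: "\<eta> * (b - a) < e / 2"
      using \<open>e > 0\<close> \<open>a \<le> b\<close> by (auto simp: \<eta>_def field_simps)
    \<comment> \<open>Quantifying over every \<open>x\<close>, with the condition inside, yields a
      radius that is positive everywhere.\<close>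
    have "\<forall>x. \<exists>d>0. x \<in> {a..b} - N \<longrightarrow> (\<forall>y\<in>{a..b}. norm (y - x) < d \<longrightarrow>
        norm (f y - f x - (y - x) *\<^sub>R f' x) \<le> \<eta> * norm (y - x))"
      using der[unfolded has_vector_derivative_def has_derivative_within_alt] \<open>\<eta> > 0\<close>
      by (metis zero_less_one)
    then obtain d where d: "\<And>x. 0 < d x"
      "\<And>x y. \<lbrakk>x \<in> {a..b} - N; y \<in> {a..b}; norm (y - x) < d x\<rbrakk>
        \<Longrightarrow> norm (f y - f x - (y - x) *\<^sub>R f' x) \<le> \<eta> * norm (y - x)"
      by metis
    have "e / 2 > 0" using \<open>e > 0\<close> by simp
    obtain \<delta> where "\<delta> > 0" and \<delta>: "\<forall>(I :: (real \<times> real set) set) x y. finite I \<and>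
        (\<forall>i\<in>I. a \<le> x i \<and> x i \<le> y i \<and> y i \<le> b) \<and>
        disjoint_family_on (\<lambda>i. {x i<..<y i}) I \<and> (\<Sum>i\<in>I. y i - x i) < \<delta>
        \<longrightarrow> (\<Sum>i\<in>I. norm (f (y i) - f (x i))) < e / 2"
      using abs_cont_on_finite[OF ac \<open>e / 2 > 0\<close>] by blast
    \<comment> \<open>Outer regularity encloses \<open>N\<close> in an open set; since
      \<open>N\<close> is null, the bound on \<open>G - N\<close> is also one on
      \<open>G\<close>.\<close>
    obtain G where G: "open G" "N \<subseteq> G" "emeasure lebesgue (G - N) < ennreal \<delta>"
      using sets_lebesgue_outer_open[OF _ \<open>\<delta> > 0\<close>] N null_setsD2 by metis
    then have emG: "emeasure lebesgue G < ennreal \<delta>"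
      using N by (simp add: emeasure_Diff_null_set)
    then have lmG: "G \<in> lmeasurable"
      using \<open>open G\<close> ennreal_less_top by (intro fmeasurableI) (auto intro: less_trans)
    have mG: "measure lebesgue G < \<delta>"
      using emG lmG \<open>\<delta> > 0\<close> by (simp add: emeasure_eq_measure2 ennreal_less_iff)
    define \<gamma> where "\<gamma> x = (if x \<in> N then G else ball x (d x))" for x
    have gauge: "gauge \<gamma>"
      using G d(1) by (auto simp: gauge_def \<gamma>_def)
    have *: "norm ((\<Sum>(x, K)\<in>p. measure lborel K *\<^sub>R h x) - (f b - f a)) < e"
      if p: "p tagged_division_of {a..b}" and fine: "\<gamma> fine p" for p
    proof -
      define \<Delta> where "\<Delta> z = (case z of (x, K) \<Rightarrow> f (Sup K) - f (Inf K))" for z :: "real \<times> real set"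
      define len where "len z = (case z of (x, K) \<Rightarrow> Sup K - Inf K)" for z :: "real \<times> real set"
      \<comment> \<open>The Riemann term of one tagged interval minus the increment of
        \<open>f\<close> over it. Increments telescope over a tagged division, so \<open>E\<close>
        sums to the total error.\<close>
      define E where "E z = (case z of (x, K) \<Rightarrow> measure lborel K *\<^sub>R h x) - \<Delta> z" for z
      note pD = tagged_division_ofD[OF p]
      have K: "\<exists>u v. K = {u..v} \<and> u \<le> v \<and> a \<le> u \<and> v \<le> b \<and> Sup K = v \<and> Inf K = u \<and> x \<in> {u..v}"
        if z: "(x, K) \<in> p" for x K
      proof -
        obtain u v where uv: "K = cbox u v"
          using pD(4)[OF z] by blast
        moreover have "x \<in> K" "K \<subseteq> {a..b}"
          using pD(2,3)[OF z] by auto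
        ultimately show ?thesis
          by (intro exI[of _ u] exI[of _ v]) auto
      qed
      have len_nonneg: "0 \<le> len z" if "z \<in> p" for z
        using K that by (cases z) (fastforce simp: len_def)
      define B where "B = {z \<in> p. fst z \<in> N}"
      have fin: "finite p" "finite B" and "B \<subseteq> p"
        using pD(1) by (auto simp: B_def)
      have good: "norm (E z) \<le> \<eta> * len z" if "z \<in> p - B" for z
      proof (cases z)
        case (Pair x K)
        with that have z: "(x, K) \<in> p" "x \<notin> N"
          by (auto simp: B_def)
        from K[OF z(1)] obtain u v where uv: "K = {u..v}" "u \<le> v" "a \<le> u" "v \<le> b"
          "Sup K = v" "Inf K = u" "x \<in> {u..v}" by blast
        have "K \<subseteq> ball x (d x)"
          using fine z unfolding fine_def \<gamma>_def by fastforce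
        then have "u \<in> ball x (d x)" "v \<in> ball x (d x)"
          using uv(1,2) by auto
        then have "norm (f u - f x - (u - x) *\<^sub>R f' x) \<le> \<eta> * norm (u - x)"
          "norm (f v - f x - (v - x) *\<^sub>R f' x) \<le> \<eta> * norm (v - x)"
          using d(2)[of x u] d(2)[of x v] uv z by (auto simp: dist_real_def)
        \<comment> \<open>The tag \<open>x\<close> lies between \<open>u\<close> and
          \<open>v\<close>: inserting \<open>f x\<close> splits the error into two linearization
          errors, and the distances from \<open>x\<close> to the endpoints add up to
          \<open>v - u\<close>.\<close>
        moreover have "E z = (f u - f x - (u - x) *\<^sub>R f' x) - (f v - f x - (v - x) *\<^sub>R f' x)"
          using uv(2) z(2) unfolding E_def \<Delta>_def Pair h_def uv(5,6) prod.case uv(1)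
          by (simp add: algebra_simps)
        ultimately have "norm (E z) \<le> \<eta> * norm (u - x) + \<eta> * norm (v - x)"
          by (smt (verit) norm_triangle_ineq4)
        also have "\<dots> = \<eta> * len z"
          unfolding len_def Pair prod.case uv(5,6) using uv(7) by (simp add: algebra_simps)
        finally show ?thesis .
      qed
      \<comment> \<open>The increments of the identity function telescope.\<close>
      have sum_len: "(\<Sum>z\<in>p. len z) = b - a"
        using additive_tagged_division_1[OF \<open>a \<le> b\<close> p, of "\<lambda>x. x"] by (simp add: len_def)
      have "norm (\<Sum>z\<in>p - B. E z) \<le> (\<Sum>z\<in>p - B. \<eta> * len z)"
        by (rule sum_norm_le) (rule good)
      also have "\<dots> = \<eta> * (\<Sum>z\<in>p - B. len z)"
        by (simp add: sum_distrib_left)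
      also have "\<dots> \<le> \<eta> * (\<Sum>z\<in>p. len z)"
        using \<open>\<eta> > 0\<close> fin len_nonneg by (intro mult_left_mono sum_mono2) auto
      finally have 1: "norm (\<Sum>z\<in>p - B. E z) < e / 2"
        using \<eta> sum_len by simp
      have disj: "disjoint_family_on (\<lambda>z. {Inf (snd z)<..<Sup (snd z)}) B"
        unfolding disjoint_family_on_def
      proof (intro ballI impI)
        fix z w assume "z \<in> B" "w \<in> B" "z \<noteq> w"
        then have *: "interior (snd z) \<inter> interior (snd w) = {}" "z \<in> p" "w \<in> p"
          using pD(5)[of "fst z" "snd z" "fst w" "snd w"] by (auto simp: B_def)
        obtain u v u' v' where "snd z = {u..v}" "u \<le> v" "snd w = {u'..v'}" "u' \<le> v'"
          using K[of "fst z" "snd z"] K[of "fst w" "snd w"] *(2,3) by auto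
        then show "{Inf (snd z)<..<Sup (snd z)} \<inter> {Inf (snd w)<..<Sup (snd w)} = {}"
          using *(1) by (simp add: interior_atLeastAtMost_real)
      qed
      have sub: "{Inf (snd z)<..<Sup (snd z)} \<subseteq> G" if "z \<in> B" for z
      proof -
        have z: "(fst z, snd z) \<in> p" "fst z \<in> N"
          using that by (auto simp: B_def)
        then have "snd z \<subseteq> G"
          using fine unfolding fine_def \<gamma>_def by fastforce
        then show ?thesis
          using K[OF z(1)] by force
      qed
      have len_B: "Sup (snd z) - Inf (snd z) = measure lebesgue {Inf (snd z)<..<Sup (snd z)}"
        if "z \<in> B" for z
        using len_nonneg[of z] that by (auto simp: B_def len_def split: prod.splits)
      \<comment> \<open>The intervals tagged in \<open>N\<close> have disjoint interiors contained
        in \<open>G\<close>, so their total length is a measure bounded by that of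
        \<open>G\<close>.\<close>
      have "(\<Sum>z\<in>B. Sup (snd z) - Inf (snd z)) = measure lebesgue (\<Union>z\<in>B. {Inf (snd z)<..<Sup (snd z)})"
        using fin disj len_B
        by (subst measure_UNION') (auto simp: disjoint_family_on_def pairwise_def disjnt_def)
      also have "\<dots> \<le> measure lebesgue G"
        using sub lmG fin(2) by (intro measure_mono_fmeasurable sets.finite_UN) auto
      finally have less: "(\<Sum>z\<in>B. Sup (snd z) - Inf (snd z)) < \<delta>"
        using mG by simp
      have "(\<Sum>z\<in>B. norm (f (Sup (snd z)) - f (Inf (snd z)))) < e / 2"
      proof (rule \<delta>[rule_format], intro conjI ballI fin(2) disj less)
        fix z assume "z \<in> B"
        then show "a \<le> Inf (snd z)" "Inf (snd z) \<le> Sup (snd z)" "Sup (snd z) \<le> b"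
          using K[of "fst z" "snd z"] \<open>B \<subseteq> p\<close> by auto
      qed
      \<comment> \<open>\<open>h\<close> vanishes at these tags, so only the increments of
        \<open>f\<close> remain.\<close>
      moreover have "norm (\<Sum>z\<in>B. E z) \<le> (\<Sum>z\<in>B. norm (f (Sup (snd z)) - f (Inf (snd z))))"
        by (rule sum_norm_le)
          (auto simp: B_def E_def \<Delta>_def h_def norm_minus_commute)
      ultimately have 2: "norm (\<Sum>z\<in>B. E z) < e / 2"
        by simp
      have "(\<Sum>(x, K)\<in>p. measure lborel K *\<^sub>R h x) - (f b - f a) = (\<Sum>z\<in>p. E z)"
        using additive_tagged_division_1[OF \<open>a \<le> b\<close> p, of f]
        by (simp add: E_def \<Delta>_def case_prod_unfold sum_subtractf)
      also have "\<dots> = (\<Sum>z\<in>p - B. E z) + (\<Sum>z\<in>B. E z)"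
        by (rule sum.subset_diff[OF \<open>B \<subseteq> p\<close> fin(1)])
      also have "norm \<dots> < e"
        using 1 2 norm_triangle_ineq by (smt (verit) field_sum_of_halves)
      finally show ?thesis .
    qed
    show "\<exists>\<gamma>. gauge \<gamma> \<and> (\<forall>p. p tagged_division_of {a..b} \<and> \<gamma> fine p \<longrightarrow>
        norm ((\<Sum>(x, K)\<in>p. measure lborel K *\<^sub>R h x) - (f b - f a)) < e)"
      using gauge * by (intro exI[of _ \<gamma>]) simp
  qed
  then show ?thesis
    by (rule has_integral_spike[OF N[folded negligible_iff_null_sets], rotated]) (simp add: h_def)
qed

section \<open>Integrating a differential inequality with an extended-real cost\<close>

lemma abs_cont_on_dissipation:
  fixes \<psi> D l :: "real \<Rightarrow> real"
  assumes "a \<le> b" and ac: "abs_cont_on a b \<psi>"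
    and deriv: "AE t in lebesgue_on {a..b}. (\<psi> has_vector_derivative D t) (at t within {a..b})"
    and l[measurable]: "l \<in> borel_measurable (lebesgue_on {a..b})"
    and nonneg: "AE t in lebesgue_on {a..b}. 0 \<le> l t + D t"
  shows "ereal (\<psi> a) \<le> ereal (\<psi> b) +
    (enn2ereal (\<integral>\<^sup>+t. ennreal (l t) \<partial>lebesgue_on {a..b})
      - enn2ereal (\<integral>\<^sup>+t. ennreal (- l t) \<partial>lebesgue_on {a..b}))"
  \<comment> \<open>\<open>D\<close> is a priori only Henstock--Kurzweil integrable; when the positive part of \<open>l\<close> is
    integrable, adding it makes \<open>D\<close> nonnegative almost everywhere, hence Lebesgue integrable.\<close>
proof (cases "(\<integral>\<^sup>+t. ennreal (l t) \<partial>lebesgue_on {a..b}) = \<infinity>")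
  \<comment> \<open>The convention \<open>\<infinity> - \<infinity> = \<infinity>\<close> makes the
    right-hand side infinite whatever the negative part contributes.\<close>
  case True
  then show ?thesis by simp
next
  case False
  let ?M = "lebesgue_on {a..b}"
  have D: "(D has_integral \<psi> b - \<psi> a) {a..b}"
    by (rule abs_cont_on_has_integral[OF \<open>a \<le> b\<close> ac deriv])
  have pos: "integrable ?M (\<lambda>t. max 0 (l t))"
  proof -
    have "ennreal (norm (max 0 (l t))) = ennreal (l t)" for t
      by (auto simp: max_def ennreal_neg)
    then show ?thesis
      using False by (simp add: integrable_iff_bounded top.not_eq_extremum)
  qed
  \<comment> \<open>The inequality \<open>nonneg\<close> holds only almost everywhere, while passing
    from gauge to absolute integrability asks for a pointwise sign; the outer \<open>max 0\<close>
    provides it and changes the function only on a null set.\<close>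
  define k where "k t = max 0 (max 0 (l t) + D t)" for t
  have k_eq: "AE t in ?M. k t = max 0 (l t) + D t"
    using nonneg by eventually_elim (auto simp: k_def)
  have "(\<lambda>t. max 0 (l t) + D t) integrable_on {a..b}"
  proof (rule Henstock_Kurzweil_Integration.integrable_add)
    show "(\<lambda>t. max 0 (l t)) integrable_on {a..b}"
      using pos by (rule integrable_on_lebesgue_on) simp
    show "D integrable_on {a..b}"
      using D by blast
  qed
  moreover have "AE t in lebesgue. t \<in> {a..b} \<longrightarrow> k t = max 0 (l t) + D t"
    using k_eq by (simp add: AE_restrict_space_iff)
  then obtain N where N: "negligible N" "\<And>t. t \<in> {a..b} - N \<Longrightarrow> k t = max 0 (l t) + D t"
    by (auto simp: eventually_ae_filter negligible_iff_null_sets)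
  ultimately have "k integrable_on {a..b}"
    using integrable_spike by blast
  then have k: "integrable ?M k"
    by (intro absolutely_integrable_imp_integrable nonnegative_absolutely_integrable_1)
      (auto simp: k_def)
  \<comment> \<open>Where \<open>l t < 0\<close>, the inequality \<open>0 \<le> l t + D t\<close>
    bounds the norm of \<open>l t\<close> by \<open>D t\<close>, which is \<open>k t\<close> there;
    elsewhere \<open>max 0 (l t)\<close> already suffices.\<close>
  have l_int: "integrable ?M l"
  proof (rule Bochner_Integration.integrable_bound[OF Bochner_Integration.integrable_add[OF pos k]])
    show "AE t in ?M. norm (l t) \<le> norm (max 0 (l t) + k t)"
      using nonneg k_eq by eventually_elim auto
  qed simp
  \<comment> \<open>\<open>k t - max 0 (l t)\<close> is a Lebesgue integrable representative of
    \<open>D\<close>, for which the Bochner and gauge integrals agree.\<close>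
  have D_int: "integrable ?M (\<lambda>t. k t - max 0 (l t))"
    using k pos by (rule Bochner_Integration.integrable_diff)
  have "((\<lambda>t. k t - max 0 (l t)) has_integral \<psi> b - \<psi> a) {a..b}"
    by (rule has_integral_spike[OF N(1) _ D]) (use N(2) in auto)
  moreover have "integral\<^sup>L ?M (\<lambda>t. k t - max 0 (l t)) = integral {a..b} (\<lambda>t. k t - max 0 (l t))"
    using D_int by (rule lebesgue_integral_eq_integral) simp
  ultimately have D_eq: "integral\<^sup>L ?M (\<lambda>t. k t - max 0 (l t)) = \<psi> b - \<psi> a"
    by (simp add: integral_unique)
  have "0 \<le> integral\<^sup>L ?M (\<lambda>t. l t + (k t - max 0 (l t)))"
  proof (rule integral_nonneg_AE)
    show "AE t in ?M. 0 \<le> l t + (k t - max 0 (l t))"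
      using nonneg k_eq by eventually_elim simp
  qed
  then have "\<psi> a \<le> \<psi> b + integral\<^sup>L ?M l"
    using l_int D_int D_eq by simp
  then show ?thesis
    \<comment> \<open>One-point state and control spaces turn \<open>cost_integrable\<close> into a
      statement about the bare function \<open>l\<close>, with constant endpoint cost
      \<open>\<psi> b\<close>.\<close>
    using cost_integrable[of a b "\<lambda>_ _. l" "\<lambda>_. ()" "\<lambda>_. ()" "\<lambda>_ _. \<psi> b"] l_int
    by (simp add: cost_def)
qed

section \<open>Absolute continuity under composition with C1 functions\<close>

text \<open>Adjoining time lets a time-dependent \<open>\<phi>\<close> be composed as a function of
  one variable. The time component adds just the total length of the intervals, hence the cap
  \<open>\<epsilon> / 2\<close> on the witness.\<close>

lemma abs_cont_on_Pair_id:
  assumes "abs_cont_on a b q"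
  shows "abs_cont_on a b (\<lambda>t. (q t, t))"
  unfolding abs_cont_on_def
proof (intro allI impI)
  fix \<epsilon> :: real assume "\<epsilon> > 0"
  then have "\<epsilon> / 2 > 0" by simp
  then obtain \<delta> where "\<delta> > 0" and \<delta>: "\<forall>(n::nat) x y.
        (\<forall>i<n. a \<le> x i \<and> x i \<le> y i \<and> y i \<le> b) \<and>
        disjoint_family_on (\<lambda>i. {x i<..<y i}) {..<n} \<and>
        (\<Sum>i<n. y i - x i) < \<delta>
        \<longrightarrow> (\<Sum>i<n. norm (q (y i) - q (x i))) < \<epsilon> / 2"
    using assms unfolding abs_cont_on_def by blast
  have "(\<Sum>i<n. norm ((q (y i), y i) - (q (x i), x i))) < \<epsilon>"
    if *: "(\<forall>i<n. a \<le> x i \<and> x i \<le> y i \<and> y i \<le> b) \<and>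
        disjoint_family_on (\<lambda>i. {x i<..<y i}) {..<n} \<and>
        (\<Sum>i<n. y i - x i) < min \<delta> (\<epsilon> / 2)" for n :: nat and x y
  proof -
    have "(\<Sum>i<n. norm ((q (y i), y i) - (q (x i), x i)))
        \<le> (\<Sum>i<n. norm (q (y i) - q (x i)) + (y i - x i))"
      using * by (intro sum_mono) (auto intro!: order.trans[OF norm_Pair_le])
    also have "\<dots> = (\<Sum>i<n. norm (q (y i) - q (x i))) + (\<Sum>i<n. y i - x i)"
      by (rule sum.distrib)
    also have "\<dots> < \<epsilon>"
      using \<delta>[rule_format, of n x y] * by auto
    finally show ?thesis .
  qed
  then show "\<exists>\<delta>>0. \<forall>(n::nat) x y. (\<forall>i<n. a \<le> x i \<and> x i \<le> y i \<and> y i \<le> b) \<and>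
      disjoint_family_on (\<lambda>i. {x i<..<y i}) {..<n} \<and> (\<Sum>i<n. y i - x i) < \<delta> \<longrightarrow>
      (\<Sum>i<n. norm ((q (y i), y i) - (q (x i), x i))) < \<epsilon>"
    using \<open>\<delta> > 0\<close> \<open>\<epsilon> > 0\<close> by (intro exI[of _ "min \<delta> (\<epsilon> / 2)"]) auto
qed

lemma abs_cont_on_compose_lipschitz:
  assumes p: "abs_cont_on a b p" and lip: "L-lipschitz_on (p ` {a..b}) f"
  shows "abs_cont_on a b (\<lambda>t. f (p t))"
  unfolding abs_cont_on_def
proof (intro allI impI)
  fix \<epsilon> :: real assume "\<epsilon> > 0"
  have "L \<ge> 0" using lip by (rule lipschitz_on_nonneg)
  \<comment> \<open>\<open>L + 1\<close> in place of \<open>L\<close> avoids dividing by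
    zero.\<close>
  then have "\<epsilon> / (L + 1) > 0" using \<open>\<epsilon> > 0\<close> by simp
  then obtain \<delta> where "\<delta> > 0" and \<delta>: "\<forall>(n::nat) x y.
        (\<forall>i<n. a \<le> x i \<and> x i \<le> y i \<and> y i \<le> b) \<and>
        disjoint_family_on (\<lambda>i. {x i<..<y i}) {..<n} \<and>
        (\<Sum>i<n. y i - x i) < \<delta>
        \<longrightarrow> (\<Sum>i<n. norm (p (y i) - p (x i))) < \<epsilon> / (L + 1)"
    using p unfolding abs_cont_on_def by blast
  have "(\<Sum>i<n. norm (f (p (y i)) - f (p (x i)))) < \<epsilon>"
    if *: "(\<forall>i<n. a \<le> x i \<and> x i \<le> y i \<and> y i \<le> b) \<and>
        disjoint_family_on (\<lambda>i. {x i<..<y i}) {..<n} \<and>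
        (\<Sum>i<n. y i - x i) < \<delta>" for n :: nat and x y
  proof -
    have "norm (f (p (y i)) - f (p (x i))) \<le> (L + 1) * norm (p (y i) - p (x i))" if "i < n" for i
    proof -
      have "a \<le> x i" "x i \<le> y i" "y i \<le> b"
        using * that by auto
      then have "norm (f (p (y i)) - f (p (x i))) \<le> L * norm (p (y i) - p (x i))"
        using lipschitz_onD[OF lip, of "p (y i)" "p (x i)"] by (auto simp: dist_norm)
      then show ?thesis
        using norm_ge_zero[of "p (y i) - p (x i)"] by (simp only: distrib_right)
    qed
    then have "(\<Sum>i<n. norm (f (p (y i)) - f (p (x i))))
        \<le> (\<Sum>i<n. (L + 1) * norm (p (y i) - p (x i)))"
      by (intro sum_mono) auto
    also have "\<dots> = (L + 1) * (\<Sum>i<n. norm (p (y i) - p (x i)))"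
      by (simp add: sum_distrib_left)
    also have "\<dots> < \<epsilon>"
      using \<delta>[rule_format, OF *] \<open>L \<ge> 0\<close> by (simp add: field_simps)
    finally show ?thesis .
  qed
  then show "\<exists>\<delta>>0. \<forall>(n::nat) x y. (\<forall>i<n. a \<le> x i \<and> x i \<le> y i \<and> y i \<le> b) \<and>
      disjoint_family_on (\<lambda>i. {x i<..<y i}) {..<n} \<and> (\<Sum>i<n. y i - x i) < \<delta> \<longrightarrow>
      (\<Sum>i<n. norm (f (p (y i)) - f (p (x i)))) < \<epsilon>"
    using \<open>\<delta> > 0\<close> by (intro exI[of _ \<delta>]) auto
qed

text \<open>The continuous derivative is bounded on the compact ball, and convexity of the ball
  turns this bound into a Lipschitz constant by the mean value inequality.\<close>

lemma C1_lipschitz_on_cball: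
  fixes f :: "'a::euclidean_space \<Rightarrow> 'b::real_normed_vector"
  assumes "C1 f"
  obtains L where "L-lipschitz_on (cball 0 R) f"
proof -
  obtain f' where f': "\<And>x. (f has_derivative blinfun_apply (f' x)) (at x)"
    and cont: "continuous_on UNIV f'"
    using assms by (auto simp: C1_def)
  have "compact (f' ` cball 0 R)"
    using cont by (intro compact_continuous_image) (auto intro: continuous_on_subset)
  then obtain L where "L > 0" and L: "\<And>x. x \<in> cball 0 R \<Longrightarrow> norm (f' x) \<le> L"
    using compact_imp_bounded bounded_pos by (metis imageI)
  have "L-lipschitz_on (cball 0 R) f"
  proof (rule bounded_derivative_imp_lipschitz[where f' = "\<lambda>x. blinfun_apply (f' x)"])
    show "onorm (blinfun_apply (f' x)) \<le> L" if "x \<in> cball 0 R" for x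
      using L[OF that] by (simp add: norm_blinfun.rep_eq)
    show "(f has_derivative blinfun_apply (f' x)) (at x within cball 0 R)" for x
      using f' by (rule has_derivative_at_withinI)
  qed (use \<open>L > 0\<close> in auto)
  then show thesis by (rule that)
qed

lemma abs_cont_on_compose_C1:
  fixes p :: "real \<Rightarrow> 'a::euclidean_space"
  assumes p: "abs_cont_on a b p" and "C1 f"
  shows "abs_cont_on a b (\<lambda>t. f (p t))"
proof -
  \<comment> \<open>The range of \<open>p\<close> is compact but need not be convex, so it is
    enclosed in a ball before a Lipschitz constant is taken.\<close>
  have "compact (p ` {a..b})"
    using abs_cont_on_imp_continuous_on[OF p] by (intro compact_continuous_image) auto
  then obtain R where "\<And>x. x \<in> p ` {a..b} \<Longrightarrow> norm x \<le> R"
    using compact_imp_bounded bounded_iff by metis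
  then have "p ` {a..b} \<subseteq> cball 0 R" by auto
  moreover obtain L where "L-lipschitz_on (cball 0 R) f"
    using C1_lipschitz_on_cball[OF \<open>C1 f\<close>] .
  ultimately show ?thesis
    using abs_cont_on_compose_lipschitz[OF p lipschitz_on_subset] by blast
qed

section \<open>Gradients and the chain rule along a trajectory\<close>

text \<open>The Riesz representative of the derivative is its adjoint applied to \<open>1\<close>,
  so the definite description behind \<open>grad\<close> denotes.\<close>

lemma GDERIV_grad:
  fixes f :: "'a::euclidean_space \<Rightarrow> real"
  assumes "f differentiable (at x)"
  shows "GDERIV f x :> grad f x"
proof -
  obtain f' where f': "(f has_derivative f') (at x)"
    using assms by (auto simp: differentiable_def)
  then have "linear f'"
    by (rule has_derivative_linear)
  then have "f' = (\<lambda>h. h \<bullet> adjoint f' 1)"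
    using adjoint_works[of f' _ 1] by auto
  with f' have "GDERIV f x :> adjoint f' 1"
    by (simp add: gderiv_def)
  then show ?thesis
    using grad_eqI by metis
qed

text \<open>Links joint differentiability to the separate partial derivatives in the Hamilton-Jacobi
  inequality, by splitting the direction into \<open>(v, 0)\<close> and
  \<open>(0, r)\<close>.\<close>

lemma has_derivative_grad_deriv:
  fixes \<phi> :: "'a::euclidean_space \<Rightarrow> real \<Rightarrow> real"
  assumes "((\<lambda>(x, s). \<phi> x s) has_derivative \<Phi>') (at (q, t))"
  shows "\<Phi>' (v, r) = grad (\<lambda>x. \<phi> x t) q \<bullet> v + deriv (\<lambda>s. \<phi> q s) t * r"
proof -
  interpret \<Phi>': bounded_linear \<Phi>'
    using assms by (rule has_derivative_bounded_linear)
  have "((\<lambda>x. (x, t)) has_derivative (\<lambda>h. (h, 0))) (at q)"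
    by (intro has_derivative_Pair has_derivative_ident has_derivative_const)
  from has_derivative_compose[OF this assms]
  have "((\<lambda>x. \<phi> x t) has_derivative (\<lambda>h. \<Phi>' (h, 0))) (at q)"
    by simp
  moreover from this have "GDERIV (\<lambda>x. \<phi> x t) q :> grad (\<lambda>x. \<phi> x t) q"
    by (intro GDERIV_grad) (auto simp: differentiable_def)
  ultimately have "(\<lambda>h. \<Phi>' (h, 0)) = (\<lambda>h. h \<bullet> grad (\<lambda>x. \<phi> x t) q)"
    unfolding gderiv_def by (rule has_derivative_unique)
  then have 1: "\<Phi>' (v, 0) = grad (\<lambda>x. \<phi> x t) q \<bullet> v"
    by (metis inner_commute)
  have scale: "\<Phi>' (0, r) = \<Phi>' (0, 1) * r" for r
    using \<Phi>'.scaleR[of r "(0, 1)"] by (simp add: mult.commute)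
  have "((\<lambda>s. (q, s)) has_derivative (\<lambda>r. (0, r))) (at t)"
    by (intro has_derivative_Pair has_derivative_ident has_derivative_const)
  from has_derivative_compose[OF this assms]
  have "((\<lambda>s. \<phi> q s) has_derivative (\<lambda>r. \<Phi>' (0, r))) (at t)"
    by simp
  moreover have "(\<lambda>r. \<Phi>' (0, r)) = (*) (\<Phi>' (0, 1))"
    by (rule ext) (rule scale)
  ultimately have "DERIV (\<lambda>s. \<phi> q s) t :> \<Phi>' (0, 1)"
    by (simp only: has_field_derivative_def)
  then have "deriv (\<lambda>s. \<phi> q s) t = \<Phi>' (0, 1)"
    by (rule DERIV_imp_deriv)
  moreover have "\<Phi>' (v, r) = \<Phi>' (v, 0) + \<Phi>' (0, r)"
    using \<Phi>'.add[of "(v, 0)" "(0, r)"] by simp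
  ultimately show ?thesis
    using 1 scale[of r] by simp
qed

text \<open>The chain rule for the curve \<open>t \<mapsto> (q t, t)\<close>, whose velocity is
  \<open>(v, 1)\<close>.\<close>

lemma has_vector_derivative_along_curve:
  fixes \<phi> :: "'a::euclidean_space \<Rightarrow> real \<Rightarrow> real"
  assumes "C1 (\<lambda>(x, s). \<phi> x s)" and q: "(q has_vector_derivative v) (at t within S)"
  shows "((\<lambda>t. \<phi> (q t) t) has_vector_derivative
    grad (\<lambda>x. \<phi> x t) (q t) \<bullet> v + deriv (\<lambda>s. \<phi> (q t) s) t) (at t within S)"
proof -
  obtain \<Phi>' where \<Phi>': "((\<lambda>(x, s). \<phi> x s) has_derivative \<Phi>') (at (q t, t))"
    using assms(1) by (auto simp: C1_def)
  have "((\<lambda>t. (q t, t)) has_vector_derivative (v, 1)) (at t within S)"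
    using q by (auto intro!: has_vector_derivative_Pair derivative_eq_intros)
  then have "((\<lambda>(x, s). \<phi> x s) \<circ> (\<lambda>t. (q t, t)) has_vector_derivative \<Phi>' (v, 1)) (at t within S)"
    by (rule vector_derivative_diff_chain_within) (rule has_derivative_at_withinI[OF \<Phi>'])
  then show ?thesis
    by (simp add: o_def has_derivative_grad_deriv[OF \<Phi>'])
qed

section \<open>Regularity of the vector field, the Hamiltonian and the running cost\<close>

lemma C2_imp_differentiable: "C2 f \<Longrightarrow> f differentiable (at x)"
  by (meson C2_def differentiableI)

text \<open>Exposes the linear dependence on \<open>(u0, u2)\<close>, which is how the controls
  enter the costate component of \<open>vfield\<close>.\<close>

lemma grad_gen_lagrangian:
  fixes g0 :: "real^'n \<Rightarrow> real" and g :: "real^'n \<Rightarrow> real^'m"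
  assumes "g0 differentiable (at x)" and g: "(g has_derivative g') (at x)"
  shows "grad (\<lambda>x. gen_lagrangian g0 g u0 x u2) x = u0 *\<^sub>R grad g0 x + adjoint g' u2"
proof (rule grad_eqI)
  have g0: "(g0 has_derivative (\<lambda>h. h \<bullet> grad g0 x)) (at x)"
    using GDERIV_grad[OF assms(1)] by (simp add: gderiv_def)
  show "GDERIV (\<lambda>x. gen_lagrangian g0 g u0 x u2) x :> u0 *\<^sub>R grad g0 x + adjoint g' u2"
    unfolding gderiv_def gen_lagrangian_def
    by (rule derivative_eq_intros g0 g refl)+
      (auto simp: inner_add_right adjoint_works[OF has_derivative_linear[OF g]] inner_commute)
qed

text \<open>At a fixed state every component is linear in the control: the Hessian and the Jacobian
  are then constant matrices.\<close>

lemma continuous_on_vfield: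
  fixes g0 :: "real^'n \<Rightarrow> real" and g :: "real^'n \<Rightarrow> real^'m"
  assumes "C2 g0" "C2 g"
  shows "continuous_on S (vfield g0 g q)"
proof -
  obtain q0 q1 q2 q3 q4 q5 where q: "q = (q0, q1, q2, q3, q4, q5)"
    by (metis prod.exhaust)
  obtain g' where g': "(g has_derivative g') (at q1)"
    using C2_imp_differentiable[OF assms(2)] by (auto simp: differentiable_def)
  then have "linear (adjoint g')"
    by (intro adjoint_linear has_derivative_linear)
  then have adj: "continuous_on S (\<lambda>u. adjoint g' (snd (snd u)))"
    for S :: "(real \<times> (real^'n) \<times> (real^'m)) set"
    by (rule linear_continuous_on_compose[rotated]) (intro continuous_intros)
  have mat: "continuous_on S (\<lambda>u. A *v fst (snd u))"
    for S :: "(real \<times> (real^'n) \<times> (real^'m)) set" and A :: "real^'n^'k"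
    by (rule linear_continuous_on_compose[rotated, OF matrix_vector_mul_linear])
      (intro continuous_intros)
  have "vfield g0 g q = (\<lambda>u. (fst u, fst (snd u), snd (snd u),
      - (hessian (\<lambda>x. gen_lagrangian g0 g q0 x q2) q1 *v fst (snd u))
        - (fst u *\<^sub>R grad g0 q1 + adjoint g' (snd (snd u))),
      jacobian g (at q1) *v fst (snd u), grad g0 q1 \<bullet> fst (snd u)))"
    using grad_gen_lagrangian[OF C2_imp_differentiable[OF assms(1)] g']
    by (auto simp: q fun_eq_iff)
  then show ?thesis
    by (simp only:) (intro continuous_intros adj mat)
qed

text \<open>A real \<open>INF\<close> is known to lie below the values only if these are bounded
  below; compactness of \<open>U q t\<close> and continuity in the control ensure that.\<close>

lemma lower_hamiltonian_le:
  fixes g0 :: "real^'n \<Rightarrow> real" and g :: "real^'n \<Rightarrow> real^'m"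
    and U :: "('n, 'm) state \<Rightarrow> real \<Rightarrow> ('n, 'm) control set"
  assumes "C2 g0" "C2 g" and "compact (U q t)" and u: "u \<in> U q t"
    and L: "(\<lambda>(q, u, t). Lrun q u t) differentiable_on UNIV"
  shows "lower_hamiltonian g0 g U Lrun q lam t \<le> hamiltonian g0 g Lrun q lam u t"
proof -
  have "continuous_on UNIV (\<lambda>(q, u, t). Lrun q u t)"
    using L by (rule differentiable_imp_continuous_on)
  then have "continuous_on (U q t) (\<lambda>u. (\<lambda>(q, u, t). Lrun q u t) (q, u, t))"
    by (rule continuous_on_compose2) (auto intro!: continuous_intros)
  then have "continuous_on (U q t) (\<lambda>u. hamiltonian g0 g Lrun q lam u t)"
    unfolding hamiltonian_def
    by (auto intro!: continuous_intros continuous_on_vfield assms)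
  then have "compact ((\<lambda>u. hamiltonian g0 g Lrun q lam u t) ` U q t)"
    using assms(3) by (intro compact_continuous_image)
  then have "bdd_below ((\<lambda>u. hamiltonian g0 g Lrun q lam u t) ` U q t)"
    by (intro bounded_imp_bdd_below compact_imp_bounded)
  then show ?thesis
    unfolding lower_hamiltonian_def using u by (rule cINF_lower)
qed

text \<open>The control is merely measurable, so the integrand is obtained by composing the jointly
  continuous \<open>f\<close> with the measurable triple of state, control and time.\<close>

lemma borel_measurable_along_curve:
  fixes f :: "'a::euclidean_space \<Rightarrow> 'b::euclidean_space \<Rightarrow> real \<Rightarrow> real"
  assumes f: "continuous_on UNIV (\<lambda>(x, u, t). f x u t)" and q: "continuous_on {a..b} q"
    and u[measurable]: "u \<in> borel_measurable (lebesgue_on {a..b})"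
  shows "(\<lambda>t. f (q t) (u t) t) \<in> borel_measurable (lebesgue_on {a..b})"
proof -
  have [measurable]: "q \<in> borel_measurable (lebesgue_on {a..b})"
    using q by (rule continuous_imp_measurable_on_sets_lebesgue) simp
  have [measurable]: "(\<lambda>t. t) \<in> borel_measurable (lebesgue_on {a..b})"
    by (rule continuous_imp_measurable_on_sets_lebesgue) (auto intro: continuous_on_id)
  have "(\<lambda>t. (\<lambda>(x, u, t). f x u t) (q t, u t, t)) \<in> borel_measurable (lebesgue_on {a..b})"
    by (rule borel_measurable_continuous_on[OF f]) measurable
  then show ?thesis by simp
qed

section \<open>The verification argument\<close>

text \<open>Concerns one primitive at a time, so \<open>HJ\<close> and \<open>terminal\<close> refer
  to its own final time only.\<close>

lemma value_le_cost:
  fixes g0 :: "real^'n \<Rightarrow> real" and g :: "real^'n \<Rightarrow> real^'m"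
    and U :: "('n, 'm) state \<Rightarrow> real \<Rightarrow> ('n, 'm) control set"
  assumes "C2 g0" "C2 g" and U: "\<And>q t. compact (U q t)"
    and L: "(\<lambda>(q, u, t). Lrun q u t) differentiable_on UNIV"
    and prim: "hidden_primitive g0 g gL gU U t0 q00 q u tf"
    and \<phi>: "C1 (\<lambda>(q, t). \<phi> q t)"
    and HJ: "\<And>q t. t \<in> {t0..tf} \<Longrightarrow>
       lower_hamiltonian g0 g U Lrun q (grad (\<lambda>x. \<phi> x t) q) t + deriv (\<lambda>s. \<phi> q s) t \<ge> 0"
    and terminal: "\<And>q. q \<in> target gL gU \<Longrightarrow> \<phi> q tf = ell q tf"
  shows "ereal (\<phi> q00 t0) \<le> cost ell Lrun t0 q u tf"
proof -
  have le: "t0 \<le> tf" and u: "u \<in> borel_measurable (lebesgue_on {t0..tf})"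
    and q: "abs_cont_on t0 tf q"
    and dq: "AE t in lebesgue_on {t0..tf}.
      (q has_vector_derivative vfield g0 g (q t) (u t)) (at t within {t0..tf})"
    and uU: "\<And>t. t \<in> {t0..tf} \<Longrightarrow> u t \<in> U (q t) t"
    and ends: "q t0 = q00" "q tf \<in> target gL gU"
    using prim by (auto simp: hidden_primitive_def caratheodory_solution_def)
  define D where "D t = grad (\<lambda>x. \<phi> x t) (q t) \<bullet> vfield g0 g (q t) (u t)
    + deriv (\<lambda>s. \<phi> (q t) s) t" for t
  have "ereal (\<phi> (q t0) t0) \<le> ereal (\<phi> (q tf) tf) +
    (enn2ereal (\<integral>\<^sup>+t. ennreal (Lrun (q t) (u t) t) \<partial>lebesgue_on {t0..tf})
      - enn2ereal (\<integral>\<^sup>+t. ennreal (- Lrun (q t) (u t) t) \<partial>lebesgue_on {t0..tf}))"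
  proof (rule abs_cont_on_dissipation[OF le])
    show "abs_cont_on t0 tf (\<lambda>t. \<phi> (q t) t)"
      using abs_cont_on_compose_C1[OF abs_cont_on_Pair_id[OF q] \<phi>] by simp
    show "AE t in lebesgue_on {t0..tf}.
        ((\<lambda>t. \<phi> (q t) t) has_vector_derivative D t) (at t within {t0..tf})"
      using dq by eventually_elim (auto simp: D_def intro: has_vector_derivative_along_curve[OF \<phi>])
    show "(\<lambda>t. Lrun (q t) (u t) t) \<in> borel_measurable (lebesgue_on {t0..tf})"
      using differentiable_imp_continuous_on[OF L] abs_cont_on_imp_continuous_on[OF q] u
      by (rule borel_measurable_along_curve)
    show "AE t in lebesgue_on {t0..tf}. 0 \<le> Lrun (q t) (u t) t + D t"
    proof (rule AE_I2)
      fix t assume "t \<in> space (lebesgue_on {t0..tf})"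
      then have t: "t \<in> {t0..tf}" by simp
      \<comment> \<open>The sum is the Hamiltonian at \<open>u t\<close>, with the gradient of
        \<open>\<phi>\<close> as costate, plus the time derivative of \<open>\<phi>\<close>.
        Admissibility of \<open>u t\<close> puts the lower Hamiltonian below it, and
        \<open>HJ\<close> applies.\<close>
      show "0 \<le> Lrun (q t) (u t) t + D t"
        using HJ[OF t, of "q t"] lower_hamiltonian_le[where U = U and Lrun = Lrun, OF assms(1,2) U uU[OF t] L]
        unfolding D_def hamiltonian_def by (smt (verit))
    qed
  qed
  then show ?thesis
    using terminal[OF ends(2)] by (simp add: cost_def ends(1))
qed

theorem theorem4p2:
  fixes g0 :: "real^'n \<Rightarrow> real"
    and g :: "real^'n \<Rightarrow> real^'m"
    and gL gU :: "real^'m"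
    and U :: "('n, 'm) state \<Rightarrow> real \<Rightarrow> ('n, 'm) control set"
    and ell :: "('n, 'm) state \<Rightarrow> real \<Rightarrow> real"
    and Lrun :: "('n, 'm) state \<Rightarrow> ('n, 'm) control \<Rightarrow> real \<Rightarrow> real"
    and t0 tfb :: real
    and q00 :: "('n, 'm) state"
    and qb :: "real \<Rightarrow> ('n, 'm) state"
    and ub :: "real \<Rightarrow> ('n, 'm) control"
    and \<phi> :: "('n, 'm) state \<Rightarrow> real \<Rightarrow> real"
  assumes g0_C2: "C2 g0"
    and g_C2: "C2 g"
    and U_compact: "\<And>q t. compact (U q t)"
    and ell_diff: "(\<lambda>(q, t). ell q t) differentiable_on UNIV"
    and Lrun_diff: "(\<lambda>(q, u, t). Lrun q u t) differentiable_on UNIV"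
    and primitive: "hidden_primitive g0 g gL gU U t0 q00 qb ub tfb"
    and phi_C1: "C1 (\<lambda>(q, t). \<phi> q t)"
    and HJ: "\<And>tf q t. tf \<in> final_times g0 g gL gU U t0 q00 \<Longrightarrow> t \<in> {t0..tf} \<Longrightarrow>
       lower_hamiltonian g0 g U Lrun q (grad (\<lambda>x. \<phi> x t) q) t + deriv (\<lambda>s. \<phi> q s) t \<ge> 0"
    and terminal: "\<And>tf q. tf \<in> final_times g0 g gL gU U t0 q00 \<Longrightarrow> q \<in> target gL gU \<Longrightarrow>
       \<phi> q tf = ell q tf"
    and initial: "ereal (\<phi> q00 t0) = cost ell Lrun t0 qb ub tfb"
  shows "solves_M g0 g gL gU U ell Lrun t0 q00 qb ub tfb \<and>
    optimal_primitive g0 g gL gU U ell Lrun t0 q00 qb tfb \<and>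
    optimal_value g0 g gL gU U ell Lrun t0 q00 = ereal (\<phi> q00 t0)"
proof -
  have lower: "ereal (\<phi> q00 t0) \<le> cost ell Lrun t0 q u tf"
    if prim: "hidden_primitive g0 g gL gU U t0 q00 q u tf" for q u tf
  proof -
    \<comment> \<open>\<open>HJ\<close> and \<open>terminal\<close> cover every final time that
      occurs in the problem; the competing primitive itself witnesses that its \<open>tf\<close> is
      one.\<close>
    have "tf \<in> final_times g0 g gL gU U t0 q00"
      using prim by (auto simp: final_times_def)
    then show ?thesis
      using HJ terminal
      by (intro value_le_cost[OF g0_C2 g_C2 U_compact Lrun_diff prim phi_C1]) auto
  qed
  then have solves: "solves_M g0 g gL gU U ell Lrun t0 q00 qb ub tfb"
    using primitive initial by (simp add: solves_M_def)
  moreover have "optimal_value g0 g gL gU U ell Lrun t0 q00 = ereal (\<phi> q00 t0)"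
    unfolding optimal_value_def
    by (rule Inf_eqI) (use lower primitive initial in auto)
  ultimately show ?thesis
    by (auto simp: optimal_primitive_def)
qed

end
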